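(* Let $(Q,\cdot,\psi)$ be a Belousov-Onoi module, let $\varphi:Q\to Q$ be the companion mapping for $\psi$, and define, for every $a,b\in Q$, \[a*b=\varphi(a)\cdot\psi(b).\] Then $(Q,* )$ is a quandle. Moreover, the quandle $(Q,* )$ is a quasigroup if and only if $\varphi$ is a permutation of $Q$.
   Context: A quasigroup is a set with a binary operation $*$ such that for all $a,b$ the equations $a*x=b$ and $y*a=b$ have unique solutions $x$, $y$, respectively. A loop $(Q,\cdot)$ is a quasigroup with a unit element $1$ (that is, $1\cdot a=a\cdot 1=a$ for every $a\in Q$). No associativity is assumed. In a loop $(Q,\cdot)$, the right division $b/^{\cdot}a$ denotes the unique $y\in Q$ with $y\cdot a=b$. Given a loop $(Q,\cdot)$ and an automorphism $\psi$ of $(Q,\cdot)$, the companion mapping for $\psi$ is the mapping $\varphi:Q\to Q$, $\varphi(x)=x/^{\cdot}\psi(x)$, i.e. $\varphi(x)$ is the unique element of $Q$ satisfying $\varphi(x)\cdot\psi(x)=x$. The triple $(Q,\cdot,\psi)$, where $(Q,\cdot)$ is a loop and $\psi$ is an automorphism of $(Q,\cdot)$ with companion mapping $\varphi$, is called a Belousov-Onoi module if \[\varphi(a\cdot b)\cdot\psi(a\cdot c)=a\cdot(\varphi(b)\cdot\psi(c))\quad\text{for all }a,b,c\in Q.\] A (left) quandle is a set $Q$ with a binary operation $*$ that is idempotent ($x*x=x$), left distributive ($x*(y*z)=(x*y)*(x*z)$), and has unique left division (for every $a,b\in Q$ there is a unique $x\in Q$ with $a*x=b$). *)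

theory Defs
  imports "HOL-Algebra.Group"
begin

locale quasigroup =
  fixes Q :: "'a set" and op :: "'a \<Rightarrow> 'a \<Rightarrow> 'a"
  assumes closed: "a \<in> Q \<Longrightarrow> b \<in> Q \<Longrightarrow> op a b \<in> Q"
    and left_division: "a \<in> Q \<Longrightarrow> b \<in> Q \<Longrightarrow> \<exists>!x. x \<in> Q \<and> op a x = b"
    and right_division: "a \<in> Q \<Longrightarrow> b \<in> Q \<Longrightarrow> \<exists>!y. y \<in> Q \<and> op y a = b"

locale quandle =
  fixes Q :: "'a set" and op :: "'a \<Rightarrow> 'a \<Rightarrow> 'a"
  assumes closed: "a \<in> Q \<Longrightarrow> b \<in> Q \<Longrightarrow> op a b \<in> Q"
    and idempotent: "x \<in> Q \<Longrightarrow> op x x = x"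
    and left_distributive:
      "x \<in> Q \<Longrightarrow> y \<in> Q \<Longrightarrow> z \<in> Q \<Longrightarrow> op x (op y z) = op (op x y) (op x z)"
    and left_division: "a \<in> Q \<Longrightarrow> b \<in> Q \<Longrightarrow> \<exists>!x. x \<in> Q \<and> op a x = b"

text \<open>The record type \<open>monoid\<close> only supplies the signature (carrier, multiplication, unit);
  associativity is not assumed.\<close>

locale loop = quasigroup "carrier G" "mult G"
  for G :: "('a, 'b) monoid_scheme" (structure) +
  assumes one_closed: "\<one> \<in> carrier G"
    and left_unit: "a \<in> carrier G \<Longrightarrow> \<one> \<otimes> a = a"
    and right_unit: "a \<in> carrier G \<Longrightarrow> a \<otimes> \<one> = a"

definition right_div :: "('a, 'b) monoid_scheme \<Rightarrow> 'a \<Rightarrow> 'a \<Rightarrow> 'a"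
  where "right_div G b a = (THE y. y \<in> carrier G \<and> y \<otimes>\<^bsub>G\<^esub> a = b)"

definition companion :: "('a, 'b) monoid_scheme \<Rightarrow> ('a \<Rightarrow> 'a) \<Rightarrow> 'a \<Rightarrow> 'a"
  where "companion G \<psi> x = right_div G x (\<psi> x)"

locale belousov_onoi_module = loop G
  for G :: "('a, 'b) monoid_scheme" (structure) and \<psi> :: "'a \<Rightarrow> 'a" +
  assumes automorphism: "\<psi> \<in> iso G G"
    and belousov_onoi:
      "a \<in> carrier G \<Longrightarrow> b \<in> carrier G \<Longrightarrow> c \<in> carrier G \<Longrightarrow>
        companion G \<psi> (a \<otimes> b) \<otimes> \<psi> (a \<otimes> c) = a \<otimes> (companion G \<psi> b \<otimes> \<psi> c)"

end

theory Submission
  imports Defs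
begin

text \<open>The Belousov-Onoi identity says that left translations of the loop are endomorphisms of
  \<open>*\<close>. Since \<open>\<psi>\<close> commutes with \<open>\<phi>\<close>, it is an endomorphism of \<open>*\<close> as well, and so is
  the left translation \<open>b \<mapsto> a * b\<close>, which is \<open>\<psi>\<close> followed by the loop translation by
  \<open>\<phi> a\<close>. The solutions \<open>y\<close> of \<open>y * a = b\<close> are the preimages under \<open>\<phi>\<close> of the quotient
  of \<open>b\<close> by \<open>\<psi> a\<close>; for \<open>a = 1\<close> this quotient is \<open>b\<close> itself.\<close>

text \<open>Unique solvability transfers along a bijection. This pulls loop division back along
  \<psi> for left division by \<open>star\<close>, and along \<phi> for right division.\<close>

lemma ex1_preimage_bij_betw:
  assumes "bij_betw f A B" and "\<exists>!z. z \<in> B \<and> P z"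
  shows "\<exists>!x. x \<in> A \<and> P (f x)"
proof -
  obtain z where z: "z \<in> B" "P z" and unique: "\<And>w. w \<in> B \<Longrightarrow> P w \<Longrightarrow> w = z"
    using assms(2) by blast
  obtain x where x: "x \<in> A" "f x = z"
    using assms(1) z(1) by (auto simp: bij_betw_def)
  show ?thesis
  proof (rule ex1I)
    show "x \<in> A \<and> P (f x)" using x z by simp
  next
    fix y assume y: "y \<in> A \<and> P (f y)"
    then have "f y = f x" using x unique bij_betwE[OF assms(1)] by blast
    then show "y = x"
      using assms(1) x y by (auto simp: bij_betw_def dest: inj_onD)
  qed
qed

lemma bij_betw_if_ex1_preimage:
  assumes "\<And>a. a \<in> A \<Longrightarrow> f a \<in> B" and "\<And>b. b \<in> B \<Longrightarrow> \<exists>!a. a \<in> A \<and> f a = b"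
  shows "bij_betw f A B"
proof (rule bij_betw_imageI)
  show "inj_on f A"
    by (rule inj_onI) (use assms in blast)
  show "f ` A = B"
  proof
    show "f ` A \<subseteq> B" using assms(1) by blast
    show "B \<subseteq> f ` A" using assms(2) by blast
  qed
qed

context belousov_onoi_module
begin

lemma psi_bij: "bij_betw \<psi> (carrier G) (carrier G)"
  using automorphism by (simp add: iso_def)

lemma psi_closed: "a \<in> carrier G \<Longrightarrow> \<psi> a \<in> carrier G"
  using psi_bij by (rule bij_betwE[rule_format])

lemma psi_mult: "a \<in> carrier G \<Longrightarrow> b \<in> carrier G \<Longrightarrow> \<psi> (a \<otimes> b) = \<psi> a \<otimes> \<psi> b"
  using automorphism by (simp add: iso_def hom_def)

text \<open>Both \<psi> \<one> and \<one> solve \<psi> \<one> \<otimes> x = \<psi> \<one>, so unique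
  left division identifies them.\<close>

lemma psi_one: "\<psi> \<one> = \<one>"
proof -
  have "\<psi> \<one> \<otimes> \<psi> \<one> = \<psi> \<one>" "\<psi> \<one> \<otimes> \<one> = \<psi> \<one>"
    using psi_mult[OF one_closed one_closed] psi_closed[OF one_closed]
    by (simp_all add: one_closed left_unit right_unit)
  then show ?thesis
    using left_division[OF psi_closed[OF one_closed] psi_closed[OF one_closed]]
      one_closed psi_closed[OF one_closed] by blast
qed

text \<open>By unique right division, a value of the companion can be recognised from its defining
  equation alone, without handling the description operator.\<close>

lemma companion_unique:
  assumes "x \<in> carrier G" "y \<in> carrier G" "y \<otimes> \<psi> x = x"
  shows "companion G \<psi> x = y"
  unfolding companion_def right_div_def
  by (rule the1_equality[OF right_division[OF psi_closed]]) (use assms in auto)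

lemma companion:
  assumes "x \<in> carrier G"
  shows companion_closed: "companion G \<psi> x \<in> carrier G"
    and companion_mult_psi: "companion G \<psi> x \<otimes> \<psi> x = x"
  using theI'[OF right_division[OF psi_closed[OF assms] assms]]
  unfolding companion_def right_div_def by auto

text \<open>Applying the automorphism \<psi> to the defining equation of the companion at x gives
  the defining equation at \<psi> x.\<close>

lemma companion_psi:
  assumes "x \<in> carrier G"
  shows "companion G \<psi> (\<psi> x) = \<psi> (companion G \<psi> x)"
proof (rule companion_unique)
  show "\<psi> (companion G \<psi> x) \<otimes> \<psi> (\<psi> x) = \<psi> x"
    using assms by (simp add: companion psi_closed flip: psi_mult)
qed (simp_all add: assms companion_closed psi_closed)

end

theorem proposition5p2:
  fixes G :: "('a, 'b) monoid_scheme"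
    and \<psi> \<phi> :: "'a \<Rightarrow> 'a"
    and star :: "'a \<Rightarrow> 'a \<Rightarrow> 'a"
  assumes "belousov_onoi_module G \<psi>"
    and "\<And>x. x \<in> carrier G \<Longrightarrow> \<phi> x = companion G \<psi> x"
    and "\<And>a b. a \<in> carrier G \<Longrightarrow> b \<in> carrier G \<Longrightarrow> star a b = \<phi> a \<otimes>\<^bsub>G\<^esub> \<psi> b"
  shows "quandle (carrier G) star \<and>
    (quasigroup (carrier G) star \<longleftrightarrow> bij_betw \<phi> (carrier G) (carrier G))"
proof
  interpret belousov_onoi_module G \<psi> by (rule assms(1))
  have phi_closed: "\<phi> x \<in> carrier G" if "x \<in> carrier G" for x
    using that by (simp add: assms(2) companion_closed)
  have star: "star a b = \<phi> a \<otimes>\<^bsub>G\<^esub> \<psi> b" if "a \<in> carrier G" "b \<in> carrier G" for a b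
    using that by (rule assms(3))
  have star_closed: "star a b \<in> carrier G" if "a \<in> carrier G" "b \<in> carrier G" for a b
    using that by (simp add: star closed phi_closed psi_closed)
  \<comment> \<open>Idempotence is exactly the defining equation of the companion.\<close>
  have star_idem: "star a a = a" if "a \<in> carrier G" for a
    using that by (simp add: star assms(2) companion_mult_psi)
  have mult_star: "a \<otimes>\<^bsub>G\<^esub> star b c = star (a \<otimes>\<^bsub>G\<^esub> b) (a \<otimes>\<^bsub>G\<^esub> c)"
    if "a \<in> carrier G" "b \<in> carrier G" "c \<in> carrier G" for a b c
    using that by (simp add: star assms(2) closed belousov_onoi)
  have psi_star: "\<psi> (star b c) = star (\<psi> b) (\<psi> c)" if "b \<in> carrier G" "c \<in> carrier G" for b c
    using that by (simp add: star assms(2) psi_closed psi_mult companion_closed companion_psi)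
  have star_left_division: "\<exists>!x. x \<in> carrier G \<and> star a x = b"
    if ab: "a \<in> carrier G" "b \<in> carrier G" for a b
  proof -
    have "\<exists>!x. x \<in> carrier G \<and> \<phi> a \<otimes>\<^bsub>G\<^esub> \<psi> x = b"
      by (intro ex1_preimage_bij_betw[OF psi_bij] left_division phi_closed ab)
    \<comment> \<open>\<open>star\<close> is specified only on the carrier, so
      \<open>conj_cong\<close> supplies the membership of x when the product is unfolded.\<close>
    then show ?thesis using ab by (simp add: star cong: conj_cong)
  qed
  show "quandle (carrier G) star"
  proof
    fix x y z assume xyz: "x \<in> carrier G" "y \<in> carrier G" "z \<in> carrier G"
    \<comment> \<open>Only products with left factor x are unfolded, so that the others stay in the
      form \<open>star\<close>: first \<psi> passes through the inner product, then the loop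
      translation by \<phi> x does.\<close>
    have "star x (star y z) = \<phi> x \<otimes>\<^bsub>G\<^esub> star (\<psi> y) (\<psi> z)"
      using xyz by (simp add: star[of x] star_closed psi_star)
    also have "\<dots> = star (star x y) (star x z)"
      using xyz by (simp add: mult_star phi_closed psi_closed star[of x])
    finally show "star x (star y z) = star (star x y) (star x z)" .
  qed (simp_all add: star_closed star_left_division star_idem)
  show "quasigroup (carrier G) star \<longleftrightarrow> bij_betw \<phi> (carrier G) (carrier G)"
  proof
    assume quasi: "quasigroup (carrier G) star"
    have "\<exists>!y. y \<in> carrier G \<and> \<phi> y = b" if "b \<in> carrier G" for b
      \<comment> \<open>Dividing by \<one> suffices: \<open>star y \<one>\<close> is \<phi> y,
        because \<psi> fixes \<one>.\<close>
      using quasigroup.right_division[OF quasi one_closed that]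
      by (simp add: star one_closed psi_one right_unit phi_closed cong: conj_cong)
    then show "bij_betw \<phi> (carrier G) (carrier G)"
      by (intro bij_betw_if_ex1_preimage phi_closed)
  next
    assume phi_bij: "bij_betw \<phi> (carrier G) (carrier G)"
    have "\<exists>!y. y \<in> carrier G \<and> star y a = b" if ab: "a \<in> carrier G" "b \<in> carrier G" for a b
    proof -
      \<comment> \<open>The loop has a unique quotient of b by \<psi> a, and bijectivity of \<phi>
        gives it a unique preimage.\<close>
      have "\<exists>!y. y \<in> carrier G \<and> \<phi> y \<otimes>\<^bsub>G\<^esub> \<psi> a = b"
        by (intro ex1_preimage_bij_betw[OF phi_bij] right_division psi_closed ab)
      then show ?thesis using ab by (simp add: star cong: conj_cong)
    qed
    then show "quasigroup (carrier G) star"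
      by unfold_locales (auto simp: star_closed star_left_division)
  qed
qed

end
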